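(* Let $(L,[\cdot,\cdot,\cdot],\alpha)$ be a 3-Hom-Lie algebra, $(V;\rho,\beta)$ a representation of it, and $T:V\to L$ an embedding tensor on $(L,[\cdot,\cdot,\cdot],\alpha)$ with respect to $(V;\rho,\beta)$. Define a trilinear map $[\cdot,\cdot,\cdot]_T:V\times V\times V\to V$ by $$[u,v,w]_T=\rho(Tu,Tv)w,\qquad u,v,w\in V.$$ Then $(V,[\cdot,\cdot,\cdot]_T,\beta)$ is a 3-Hom-Leibniz algebra. Moreover, $T$ is a homomorphism from the 3-Hom-Leibniz algebra $(V,[\cdot,\cdot,\cdot]_T,\beta)$ to the 3-Hom-Lie algebra $(L,[\cdot,\cdot,\cdot],\alpha)$, i.e. $T\circ\beta=\alpha\circ T$ and $T([u,v,w]_T)=[Tu,Tv,Tw]$ for all $u,v,w\in V$.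
   Context: All vector spaces are over a field $\mathbb{K}$ of characteristic $0$. A 3-Hom-Lie algebra $(L,[\cdot,\cdot,\cdot],\alpha)$ is a vector space $L$ with a trilinear skew-symmetric map $[\cdot,\cdot,\cdot]:L\times L\times L\to L$ and a linear map $\alpha:L\to L$ such that $\alpha([x,y,z])=[\alpha(x),\alpha(y),\alpha(z)]$ and $$[\alpha(a),\alpha(b),[x,y,z]]=[[a,b,x],\alpha(y),\alpha(z)]+[\alpha(x),[a,b,y],\alpha(z)]+[\alpha(x),\alpha(y),[a,b,z]]$$ for all $a,b,x,y,z\in L$. A 3-Hom-Leibniz algebra $(\mathcal{L},[\cdot,\cdot,\cdot]_{\mathcal{L}},\alpha_{\mathcal{L}})$ is defined by the same data and the same two identities, except that the trilinear bracket is not required to be skew-symmetric. A representation $(V;\rho,\beta)$ of $(L,[\cdot,\cdot,\cdot],\alpha)$ is a vector space $V$ with $\beta\in\mathrm{End}(V)$ and a skew-symmetric linear map $\rho:\wedge^2L\to\mathrm{End}(V)$ such that for all $x,y,a,b\in L$: $$\rho(\alpha(x),\alpha(y))\circ\beta=\beta\circ\rho(x,y),$$ $$\rho(\alpha(x),\alpha(y))\rho(a,b)-\rho(\alpha(a),\alpha(b))\rho(x,y)=(\rho([x,y,a],\alpha(b))-\rho([x,y,b],\alpha(a)))\circ\beta,$$ $$\rho([x,y,a],\alpha(b))\circ\beta-\rho(\alpha(y),\alpha(a))\rho(x,b)=\rho(\alpha(a),\alpha(x))\rho(y,b)+\rho(\alpha(x),\alpha(y))\rho(a,b).$$ An embedding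 tensor on $L$ with respect to $(V;\rho,\beta)$ is a linear map $T:V\to L$ with $T\circ\beta=\alpha\circ T$ and $[Tu,Tv,Tw]=T(\rho(Tu,Tv)w)$ for all $u,v,w\in V$. *)

theory Defs
  imports Complex_Main
begin

text \<open>
  Vector spaces are given by scalar multiplications on whole types (locale
  \<open>vector_space\<close>), of arbitrary dimension. The name \<open>Vector_Spaces.linear\<close> is qualified
  because plain \<open>linear\<close> denotes real linearity in \<open>Complex_Main\<close>.
\<close>

locale trilinear_map =
  fixes scale :: "'k::field_char_0 \<Rightarrow> 'v::ab_group_add \<Rightarrow> 'v"
    and br :: "'v \<Rightarrow> 'v \<Rightarrow> 'v \<Rightarrow> 'v"
  assumes linear_arg1: "Vector_Spaces.linear scale scale (\<lambda>x. br x y z)"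
    and linear_arg2: "Vector_Spaces.linear scale scale (\<lambda>y. br x y z)"
    and linear_arg3: "Vector_Spaces.linear scale scale (\<lambda>z. br x y z)"

locale three_hom_leibniz_algebra = trilinear_map scale br
  for scale :: "'k::field_char_0 \<Rightarrow> 'v::ab_group_add \<Rightarrow> 'v"
    and br :: "'v \<Rightarrow> 'v \<Rightarrow> 'v \<Rightarrow> 'v" +
  fixes \<alpha> :: "'v \<Rightarrow> 'v"
  assumes linear_twist: "Vector_Spaces.linear scale scale \<alpha>"
    and multiplicative: "\<alpha> (br x y z) = br (\<alpha> x) (\<alpha> y) (\<alpha> z)"
    and hom_leibniz_identity:
      "br (\<alpha> a) (\<alpha> b) (br x y z) =
         br (br a b x) (\<alpha> y) (\<alpha> z) + br (\<alpha> x) (br a b y) (\<alpha> z) + br (\<alpha> x) (\<alpha> y) (br a b z)"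

locale three_hom_lie_algebra = three_hom_leibniz_algebra scale br \<alpha>
  for scale :: "'k::field_char_0 \<Rightarrow> 'v::ab_group_add \<Rightarrow> 'v"
    and br :: "'v \<Rightarrow> 'v \<Rightarrow> 'v \<Rightarrow> 'v"
    and \<alpha> :: "'v \<Rightarrow> 'v" +
  assumes skew12: "br y x z = - br x y z"
    and skew23: "br x z y = - br x y z"
    and skew13: "br z y x = - br x y z"

text \<open>
  The map \<open>\<rho> : \<And>\<^sup>2 L \<rightarrow> End(V)\<close> is encoded as a skew-symmetric bilinear map; linearity into
  \<open>End(V)\<close> in either argument is linearity of all evaluations at \<open>v\<close>. In the same way
  identities between endomorphisms of \<open>V\<close> are stated at every \<open>v\<close>.
\<close>

locale three_hom_lie_representation = three_hom_lie_algebra sL br \<alpha>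
  for sL :: "'k::field_char_0 \<Rightarrow> 'l::ab_group_add \<Rightarrow> 'l"
    and br :: "'l \<Rightarrow> 'l \<Rightarrow> 'l \<Rightarrow> 'l"
    and \<alpha> :: "'l \<Rightarrow> 'l" +
  fixes sV :: "'k \<Rightarrow> 'v::ab_group_add \<Rightarrow> 'v"
    and \<rho> :: "'l \<Rightarrow> 'l \<Rightarrow> 'v \<Rightarrow> 'v"
    and \<beta> :: "'v \<Rightarrow> 'v"
  assumes linear_rep_twist: "Vector_Spaces.linear sV sV \<beta>"
    and rep_endomorphism: "Vector_Spaces.linear sV sV (\<rho> x y)"
    and rep_linear1: "Vector_Spaces.linear sL sV (\<lambda>x. \<rho> x y v)"
    and rep_linear2: "Vector_Spaces.linear sL sV (\<lambda>y. \<rho> x y v)"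
    and rep_skew: "\<rho> y x v = - \<rho> x y v"
    and rep_twist: "\<rho> (\<alpha> x) (\<alpha> y) (\<beta> v) = \<beta> (\<rho> x y v)"
    and rep_commutator:
      "\<rho> (\<alpha> x) (\<alpha> y) (\<rho> a b v) - \<rho> (\<alpha> a) (\<alpha> b) (\<rho> x y v) =
         \<rho> (br x y a) (\<alpha> b) (\<beta> v) - \<rho> (br x y b) (\<alpha> a) (\<beta> v)"
    and rep_bracket:
      "\<rho> (br x y a) (\<alpha> b) (\<beta> v) - \<rho> (\<alpha> y) (\<alpha> a) (\<rho> x b v) =
         \<rho> (\<alpha> a) (\<alpha> x) (\<rho> y b v) + \<rho> (\<alpha> x) (\<alpha> y) (\<rho> a b v)"

locale embedding_tensor = three_hom_lie_representation sL br \<alpha> sV \<rho> \<beta>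
  for sL :: "'k::field_char_0 \<Rightarrow> 'l::ab_group_add \<Rightarrow> 'l"
    and br :: "'l \<Rightarrow> 'l \<Rightarrow> 'l \<Rightarrow> 'l"
    and \<alpha> :: "'l \<Rightarrow> 'l"
    and sV :: "'k \<Rightarrow> 'v::ab_group_add \<Rightarrow> 'v"
    and \<rho> :: "'l \<Rightarrow> 'l \<Rightarrow> 'v \<Rightarrow> 'v"
    and \<beta> :: "'v \<Rightarrow> 'v" +
  fixes T :: "'v \<Rightarrow> 'l"
  assumes linear_tensor: "Vector_Spaces.linear sV sL T"
    and tensor_twist: "T \<circ> \<beta> = \<alpha> \<circ> T"
    and tensor_bracket: "br (T u) (T v) (T w) = T (\<rho> (T u) (T v) w)"

definition induced_bracket ::
    "('l \<Rightarrow> 'l \<Rightarrow> 'v \<Rightarrow> 'v) \<Rightarrow> ('v \<Rightarrow> 'l) \<Rightarrow> 'v \<Rightarrow> 'v \<Rightarrow> 'v \<Rightarrow> 'v"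
  where "induced_bracket \<rho> T u v w = \<rho> (T u) (T v) w"

text \<open>The target may in particular be a 3-Hom-Lie algebra, which is a 3-Hom-Leibniz algebra.\<close>

locale three_hom_leibniz_hom =
  dom: three_hom_leibniz_algebra s1 br1 \<alpha>1 + cod: three_hom_leibniz_algebra s2 br2 \<alpha>2
  for s1 :: "'k::field_char_0 \<Rightarrow> 'v::ab_group_add \<Rightarrow> 'v"
    and br1 :: "'v \<Rightarrow> 'v \<Rightarrow> 'v \<Rightarrow> 'v"
    and \<alpha>1 :: "'v \<Rightarrow> 'v"
    and s2 :: "'k \<Rightarrow> 'w::ab_group_add \<Rightarrow> 'w"
    and br2 :: "'w \<Rightarrow> 'w \<Rightarrow> 'w \<Rightarrow> 'w"
    and \<alpha>2 :: "'w \<Rightarrow> 'w" +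
  fixes f :: "'v \<Rightarrow> 'w"
  assumes hom_linear: "Vector_Spaces.linear s1 s2 f"
    and hom_twist: "f \<circ> \<alpha>1 = \<alpha>2 \<circ> f"
    and hom_bracket: "f (br1 u v w) = br2 (f u) (f v) (f w)"

end

theory Submission
  imports Defs
begin

text \<open>Through \<open>T\<close>, each axiom for the bracket on V becomes an axiom of the
  representation evaluated at points of the image of \<open>T\<close>. Multiplicativity of \<beta>
  comes from \<open>rep_twist\<close>. The Hom-Leibniz identity, proved in
  \<open>induced_hom_leibniz_identity\<close>, comes from \<open>rep_commutator\<close>:
  \<open>tensor_bracket\<close> turns a bracket of images into the image of an induced bracket, and
  \<open>tensor_twist\<close> turns \<alpha> after \<open>T\<close> into \<open>T\<close> after
  \<beta>. Those same two conditions say that \<open>T\<close> is a homomorphism.\<close>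

context embedding_tensor
begin

lemma tensor_twist_apply: "T (\<beta> u) = \<alpha> (T u)"
  using tensor_twist by (metis comp_apply)

lemma trilinear_induced_bracket: "trilinear_map sV (induced_bracket \<rho> T)"
proof (rule trilinear_map.intro)
  fix u v w
  show "Vector_Spaces.linear sV sV (\<lambda>u. induced_bracket \<rho> T u v w)"
    using Vector_Spaces.linear_compose[OF linear_tensor rep_linear1] by (simp add: induced_bracket_def comp_def)
  show "Vector_Spaces.linear sV sV (\<lambda>v. induced_bracket \<rho> T u v w)"
    using Vector_Spaces.linear_compose[OF linear_tensor rep_linear2] by (simp add: induced_bracket_def comp_def)
  show "Vector_Spaces.linear sV sV (\<lambda>w. induced_bracket \<rho> T u v w)"
    using rep_endomorphism by (simp add: induced_bracket_def)
qed

lemma induced_hom_leibniz_identity: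
  defines "brT \<equiv> induced_bracket \<rho> T"
  shows "brT (\<beta> a) (\<beta> b) (brT x y z) =
    brT (brT a b x) (\<beta> y) (\<beta> z) + brT (\<beta> x) (brT a b y) (\<beta> z) + brT (\<beta> x) (\<beta> y) (brT a b z)"
proof -
  \<comment> \<open>The commutator law for the pairs (\<open>T a\<close>, \<open>T b\<close>) and
    (\<open>T x\<close>, \<open>T y\<close>), with the subtracted composite moved to the
    right.\<close>
  have "\<rho> (\<alpha> (T a)) (\<alpha> (T b)) (\<rho> (T x) (T y) z) =
      \<rho> (br (T a) (T b) (T x)) (\<alpha> (T y)) (\<beta> z) - \<rho> (br (T a) (T b) (T y)) (\<alpha> (T x)) (\<beta> z)
      + \<rho> (\<alpha> (T x)) (\<alpha> (T y)) (\<rho> (T a) (T b) z)"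
    using rep_commutator by (metis diff_add_cancel)
  \<comment> \<open>Skew-symmetry absorbs the minus sign and puts the inner bracket in the second
    slot, as the middle Leibniz term requires.\<close>
  moreover have "- \<rho> (br (T a) (T b) (T y)) (\<alpha> (T x)) (\<beta> z) =
      \<rho> (\<alpha> (T x)) (br (T a) (T b) (T y)) (\<beta> z)"
    by (rule rep_skew[symmetric])
  ultimately show ?thesis
    \<comment> \<open>Differences are kept as sums with a negated term, so that the skew-symmetry
      equation can rewrite that term.\<close>
    by (simp add: diff_conv_add_uminus del: add_uminus_conv_diff add: brT_def induced_bracket_def tensor_twist_apply tensor_bracket)
qed

lemma three_hom_leibniz_algebra_induced:
  "three_hom_leibniz_algebra sV (induced_bracket \<rho> T) \<beta>"
proof (intro three_hom_leibniz_algebra.intro three_hom_leibniz_algebra_axioms.intro)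
  show "\<beta> (induced_bracket \<rho> T x y z) = induced_bracket \<rho> T (\<beta> x) (\<beta> y) (\<beta> z)" for x y z
    by (simp add: induced_bracket_def tensor_twist_apply rep_twist)
qed (fact trilinear_induced_bracket linear_rep_twist induced_hom_leibniz_identity)+

lemma three_hom_leibniz_hom_tensor:
  "three_hom_leibniz_hom sV (induced_bracket \<rho> T) \<beta> sL br \<alpha> T"
proof (intro three_hom_leibniz_hom.intro three_hom_leibniz_hom_axioms.intro)
  show "T (induced_bracket \<rho> T u v w) = br (T u) (T v) (T w)" for u v w
    by (simp add: induced_bracket_def tensor_bracket)
\<comment> \<open>The structure on the target is the one L inherits as a 3-Hom-Lie algebra.\<close>
qed (fact three_hom_leibniz_algebra_induced three_hom_leibniz_algebra_axioms
  linear_tensor tensor_twist)+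

end

theorem proposition2p8:
  fixes sL :: "'k::field_char_0 \<Rightarrow> 'l::ab_group_add \<Rightarrow> 'l"
    and br :: "'l \<Rightarrow> 'l \<Rightarrow> 'l \<Rightarrow> 'l"
    and \<alpha> :: "'l \<Rightarrow> 'l"
    and sV :: "'k \<Rightarrow> 'v::ab_group_add \<Rightarrow> 'v"
    and \<rho> :: "'l \<Rightarrow> 'l \<Rightarrow> 'v \<Rightarrow> 'v"
    and \<beta> :: "'v \<Rightarrow> 'v"
    and T :: "'v \<Rightarrow> 'l"
  assumes "three_hom_lie_algebra sL br \<alpha>"
    and "three_hom_lie_representation sL br \<alpha> sV \<rho> \<beta>"
    and "embedding_tensor sL br \<alpha> sV \<rho> \<beta> T"
  shows "three_hom_leibniz_algebra sV (induced_bracket \<rho> T) \<beta> \<and>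
         three_hom_leibniz_hom sV (induced_bracket \<rho> T) \<beta> sL br \<alpha> T"
  using assms(3) embedding_tensor.three_hom_leibniz_algebra_induced
    embedding_tensor.three_hom_leibniz_hom_tensor by blast

end
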